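(* Let $G'$ be a connected graph with $\lambda_1(G')>2$, let $r\ge1$, and let $X=G'\square_\sigma H_r$ be an $H_r$-bundle over $G'$. The following conditions are equivalent: (i) $X$ is $H_r$-bundle isomorphic to $G'\,\square\,H_r$; (ii) there exists $f\in E_2(X)$ such that $f|_{\{x\}\times H_r}$ is injective for every $x\in V(G')$; (iii) for any base point $x_0\in V(G')$, the group $\Gamma_{x_0}$ is trivial; (iv) $m_2(X)=r$.
   Context: All graphs are simple, finite and unweighted. For $f:V(X)\to\mathbb{R}$ put $Lf(x)=\sum_{y\sim x}(f(y)-f(x))$; $\lambda_1$ is the smallest nonzero eigenvalue of $-L$ on a connected graph. $E_2(X)=\ker(L+2I)$ and $m_2(X)=\dim E_2(X)$. $H_r$ is the $r$-dimensional hypercube: vertex set $\mathbb{F}_2^r$, two vertices adjacent iff they differ in exactly one coordinate. $\square$ denotes the Cartesian product of graphs. Graph bundles: given graphs $G',F$ and a map $\sigma$ assigning to each oriented edge $(x,y)$ of $G'$ an automorphism $\sigma_{xy}\in\operatorname{Aut}(F)$ with $\sigma_{yx}=\sigma_{xy}^{-1}$, the $F$-bundle $G'\square_\sigma F$ over $G'$ has vertex set $V(G')\times V(F)$ and edges $(x,u)\sim(y,\sigma_{xy}(u))$ whenever $x\sim y$ in $G'$, and $(x,u)\sim(x,v)$ whenever $u\sim v$ in $F$. The Cartesian product $G'\square F$ is the bundle with all $\sigma_{xy}=\mathrm{id}$. Two $F$-bundles over $G'$ are $F$-bundle isomorphic if there is a graph isomorphism $\Psi$ between them with $\pi\circ\Psi=\pi$,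 where $\pi$ denotes the projection to $V(G')$. For a walk $\gamma=y_0\cdots y_n$ in $G'$ put $\sigma_\gamma=\sigma_{y_{n-1}y_n}\circ\cdots\circ\sigma_{y_0y_1}$, and for $x_0\in V(G')$ let $\Gamma_{x_0}=\{\sigma_\gamma:\gamma\text{ a closed walk in }G'\text{ based at }x_0\}\le\operatorname{Aut}(H_r)$. *)

theory Defs
  imports "HOL-Analysis.Analysis" "HOL-Library.Z2"
begin

(* A graph is given by its adjacency relation; its vertex set is the whole type, which is of
   class finite wherever finiteness matters. *)

type_synonym 'v graph = "'v \<Rightarrow> 'v \<Rightarrow> bool"

definition simple_graph :: "'v graph \<Rightarrow> bool" where
  "simple_graph G \<longleftrightarrow> symp G \<and> irreflp G"

definition connected_graph :: "'v graph \<Rightarrow> bool" where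
  "connected_graph G \<longleftrightarrow> (\<forall>x y. G\<^sup>*\<^sup>* x y)"

definition graph_iso :: "'v graph \<Rightarrow> 'w graph \<Rightarrow> ('v \<Rightarrow> 'w) \<Rightarrow> bool" where
  "graph_iso G H \<psi> \<longleftrightarrow> bij \<psi> \<and> (\<forall>x y. G x y \<longleftrightarrow> H (\<psi> x) (\<psi> y))"

definition graph_Aut :: "'v graph \<Rightarrow> ('v \<Rightarrow> 'v) set" where
  "graph_Aut G = {\<psi>. graph_iso G G \<psi>}"

(* Real functions on the vertices are vectors indexed by vertices, so that the library's
   linear algebra (in particular dim) applies. *)

definition laplacian :: "'v::finite graph \<Rightarrow> real ^ 'v \<Rightarrow> real ^ 'v" where
  "laplacian G f = (\<chi> x. \<Sum>y | G x y. f $ y - f $ x)"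

definition laplace_spectrum :: "'v::finite graph \<Rightarrow> real set" where
  "laplace_spectrum G = {\<mu>. \<exists>f. f \<noteq> 0 \<and> - laplacian G f = \<mu> *\<^sub>R f}"

(* The spectrum is finite, so the infimum is a minimum as soon as there is a nonzero eigenvalue.
   The one-vertex graph has none, and then lambda1 is infinity. *)
definition lambda1 :: "'v::finite graph \<Rightarrow> ereal" where
  "lambda1 G = Inf (ereal ` (laplace_spectrum G - {0}))"

definition E2 :: "'v::finite graph \<Rightarrow> (real ^ 'v) set" where
  "E2 G = {f. laplacian G f + 2 *\<^sub>R f = 0}"

definition m2 :: "'v::finite graph \<Rightarrow> nat" where
  "m2 G = dim (E2 G)"

instance bit :: finite
proof
  have "(UNIV :: bit set) = {0, 1}"
    using bit_not_zero_iff by auto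
  then show "finite (UNIV :: bit set)"
    by (metis finite.emptyI finite.insertI)
qed

(* The type bit is the field with two elements; the dimension r is CARD('r), hence r >= 1. *)
definition hypercube :: "(bit ^ 'r::finite) graph" where
  "hypercube u v \<longleftrightarrow> card {i. u $ i \<noteq> v $ i} = 1"

definition bundle_data :: "'v graph \<Rightarrow> 'w graph \<Rightarrow> ('v \<Rightarrow> 'v \<Rightarrow> 'w \<Rightarrow> 'w) \<Rightarrow> bool" where
  "bundle_data G F \<sigma> \<longleftrightarrow>
     (\<forall>x y. G x y \<longrightarrow> \<sigma> x y \<in> graph_Aut F \<and> \<sigma> y x = inv (\<sigma> x y))"

definition graph_bundle :: "'v graph \<Rightarrow> 'w graph \<Rightarrow> ('v \<Rightarrow> 'v \<Rightarrow> 'w \<Rightarrow> 'w) \<Rightarrow> ('v \<times> 'w) graph" where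
  "graph_bundle G F \<sigma> p q \<longleftrightarrow>
     G (fst p) (fst q) \<and> snd q = \<sigma> (fst p) (fst q) (snd p) \<or>
     fst p = fst q \<and> F (snd p) (snd q)"

definition cartesian_product :: "'v graph \<Rightarrow> 'w graph \<Rightarrow> ('v \<times> 'w) graph" where
  "cartesian_product G F = graph_bundle G F (\<lambda>_ _. id)"

definition bundle_isomorphic :: "('v \<times> 'w) graph \<Rightarrow> ('v \<times> 'w) graph \<Rightarrow> bool" where
  "bundle_isomorphic X Y \<longleftrightarrow> (\<exists>\<psi>. graph_iso X Y \<psi> \<and> fst \<circ> \<psi> = fst)"

(* Walks are nonempty vertex lists; a single vertex is a walk of length 0. *)
definition walk :: "'v graph \<Rightarrow> 'v list \<Rightarrow> bool" where
  "walk G \<gamma> \<longleftrightarrow> \<gamma> \<noteq> [] \<and> successively G \<gamma>"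

fun transport :: "('v \<Rightarrow> 'v \<Rightarrow> 'w \<Rightarrow> 'w) \<Rightarrow> 'v list \<Rightarrow> 'w \<Rightarrow> 'w" where
  "transport \<sigma> (x # y # \<gamma>) = transport \<sigma> (y # \<gamma>) \<circ> \<sigma> x y"
| "transport \<sigma> _ = id"

definition holonomy :: "'v graph \<Rightarrow> ('v \<Rightarrow> 'v \<Rightarrow> 'w \<Rightarrow> 'w) \<Rightarrow> 'v \<Rightarrow> ('w \<Rightarrow> 'w) set" where
  "holonomy G \<sigma> x0 = {transport \<sigma> \<gamma> | \<gamma>. walk G \<gamma> \<and> hd \<gamma> = x0 \<and> last \<gamma> = x0}"

lemma simple_graph_hypercube: "simple_graph (hypercube :: (bit ^ 'r::finite) graph)"
  by (auto simp: simple_graph_def hypercube_def symp_def irreflp_def eq_commute)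

lemma simple_graph_bundle:
  assumes "simple_graph G" "simple_graph F" "bundle_data G F \<sigma>"
  shows "simple_graph (graph_bundle G F \<sigma>)"
proof -
  have "graph_bundle G F \<sigma> q p" if pq: "graph_bundle G F \<sigma> p q" for p q
  proof (cases "fst p = fst q \<and> F (snd p) (snd q)")
    case True
    then show ?thesis
      using assms(2) by (auto simp: graph_bundle_def simple_graph_def dest: sympD)
  next
    case False
    then have e: "G (fst p) (fst q)" "snd q = \<sigma> (fst p) (fst q) (snd p)"
      using pq by (auto simp: graph_bundle_def)
    then have "bij (\<sigma> (fst p) (fst q))" "\<sigma> (fst q) (fst p) = inv (\<sigma> (fst p) (fst q))"
      using assms(3) by (auto simp: bundle_data_def graph_Aut_def graph_iso_def)
    then have "snd p = \<sigma> (fst q) (fst p) (snd q)"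
      using e(2) by (simp add: bij_is_inj)
    then show ?thesis
      using e(1) assms(1) by (auto simp: graph_bundle_def simple_graph_def dest: sympD)
  qed
  then show ?thesis
    using assms(1,2) by (auto simp: simple_graph_def graph_bundle_def irreflp_def intro: sympI)
qed

end

theory Submission
  imports Defs
begin

text \<open>
  Everything follows from a description of the eigenspace of the bundle: if $\lambda_1 > 2$ on the
  base, then \<open>f\<close> lies in \<open>E2 X\<close> exactly when it is constant along horizontal edges
  (\<open>parallel\<close>) and restricts on each fibre to an element of \<open>E2\<close> of the cube. Sufficiency is
  immediate (\<open>parallel_E2I\<close>). For necessity (\<open>E2_parallel\<close>, \<open>fibre_E2\<close>), the fibre sums of
  \<open>f\<close> satisfy $L A = -2 A$ on the base, so they vanish because 2 is not an eigenvalue there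
  (\<open>fibre_sum_zero\<close>). By the Poincare inequality of the cube (\<open>poincare_hypercube\<close>) the vertical
  part of the Dirichlet energy is then at least $2 \|f\|^2$. The total energy is exactly
  $2 \|f\|^2$, so the horizontal part is zero, which means that \<open>f\<close> is parallel.
  
  Over a connected base a parallel function is determined by one fibre, and there it is invariant
  under the holonomy group. Restriction to the fibre over \<open>x0\<close> thus embeds \<open>E2 X\<close> into the space
  \<open>E2\<close> of the cube, which consists of the linear forms in the signs $(-1)^{u_i}$ and has dimension
  $r$ (\<open>E2_hypercube\<close>). A linear form with suitable coefficients is injective on the cube
  (\<open>injective_E2_hypercube\<close>), and a permutation that preserves an injective function is the
  identity.
  
  The implications are now short. An isomorphism with the product pulls an injective form on the
  cube back to \<open>X\<close>. A function in \<open>E2 X\<close> that is injective on the fibres forces the holonomy to be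
  trivial. Trivial holonomy makes parallel transport independent of the walk, and so trivializes
  the bundle (\<open>parallel_frame\<close>). The product has $m_2 = r$, the functions pulled back from the cube
  filling the whole space. Finally, if $m_2 = r$, then the restriction to a fibre is onto, so an
  injective form on the cube extends to \<open>E2 X\<close>, and the holonomy is trivial.
\<close>

section \<open>Fourier analysis on the hypercube\<close>

definition flip :: "'r \<Rightarrow> bit ^ 'r::finite \<Rightarrow> bit ^ 'r" where
  "flip i u = (\<chi> j. if j = i then u $ j + 1 else u $ j)"

definition rademacher :: "'r \<Rightarrow> bit ^ 'r::finite \<Rightarrow> real" where
  "rademacher i u = (if u $ i = 0 then 1 else -1)"

definition walsh :: "'r set \<Rightarrow> bit ^ 'r::finite \<Rightarrow> real" where
  "walsh S u = (\<Prod>i\<in>S. rademacher i u)"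

definition fourier :: "real ^ (bit ^ 'r::finite) \<Rightarrow> 'r set \<Rightarrow> real" where
  "fourier g S = (\<Sum>u\<in>UNIV. g $ u * walsh S u)"

lemma bit_eq_iff_neq: "(a::bit) = b + 1 \<longleftrightarrow> a \<noteq> b"
  by (cases a; cases b) auto

lemma flip_nth: "flip i u $ j = (if j = i then u $ j + 1 else u $ j)"
  by (simp add: flip_def)

lemma flip_flip [simp]: "flip i (flip i u) = u"
  by (simp add: vec_eq_iff flip_nth add.assoc)

lemma hypercube_iff_flip: "hypercube u v \<longleftrightarrow> (\<exists>i. v = flip i u)"
proof -
  have "{i. u $ i \<noteq> v $ i} = {i} \<longleftrightarrow> v = flip i u" for i
    unfolding set_eq_iff vec_eq_iff flip_nth mem_Collect_eq singleton_iff
    using bit_eq_iff_neq by metis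
  then show ?thesis
    by (simp add: hypercube_def card_1_singleton_iff)
qed

lemma laplacian_hypercube:
  "laplacian hypercube g $ u = (\<Sum>i\<in>UNIV. g $ flip i u - g $ u)"
proof -
  have "inj (\<lambda>i. flip i u)"
  proof (rule injI)
    fix i j assume "flip i u = flip j u"
    then have "flip i u $ i = flip j u $ i" by simp
    then show "i = j"
      by (metis bit_eq_iff_neq flip_nth)
  qed
  moreover have "{v. hypercube u v} = range (\<lambda>i. flip i u)"
    by (auto simp: hypercube_iff_flip)
  ultimately show ?thesis
    by (simp add: laplacian_def sum.reindex)
qed

lemma rademacher_flip: "rademacher j (flip i u) = (if j = i then - rademacher j u else rademacher j u)"
  by (cases "u $ i") (auto simp: rademacher_def flip_nth)

lemma rademacher_square [simp]: "rademacher i u * rademacher i u = 1"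
  by (simp add: rademacher_def)

lemma rademacher_separates:
  assumes "\<And>i. rademacher i u = rademacher i v"
  shows "u = v"
proof -
  have "u $ i = v $ i" for i
    using assms[of i] by (cases "u $ i"; cases "v $ i") (auto simp: rademacher_def)
  then show ?thesis by (simp add: vec_eq_iff)
qed

lemma walsh_flip: "walsh S (flip i u) = (if i \<in> S then - walsh S u else walsh S u)"
proof (cases "i \<in> S")
  case True
  have "walsh S v = rademacher i v * (\<Prod>j\<in>S - {i}. rademacher j v)" for v
    unfolding walsh_def using True by (intro prod.remove) auto
  moreover have "(\<Prod>j\<in>S - {i}. rademacher j (flip i u)) = (\<Prod>j\<in>S - {i}. rademacher j u)"
    by (intro prod.cong) (auto simp: rademacher_flip)
  ultimately show ?thesis
    using True by (simp add: rademacher_flip)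
next
  case False
  then show ?thesis
    unfolding walsh_def by (auto simp: rademacher_flip intro!: prod.cong)
qed

text \<open>
  The Walsh function of \<open>S\<close> changes sign under exactly those flips whose coordinate lies in \<open>S\<close>, so
  it is an eigenfunction of the Laplacian with eigenvalue $-2|S|$. Reindexing along the involutions
  \<open>flip i\<close> moves the Laplacian from \<open>g\<close> onto it.
\<close>

lemma fourier_laplacian:
  fixes g :: "real ^ (bit ^ 'r::finite)"
  shows "fourier (laplacian hypercube g) S = - 2 * real (card S) * fourier g S"
proof -
  have reflect: "(\<Sum>u\<in>UNIV. g $ flip i u * walsh S u) = (\<Sum>u\<in>UNIV. g $ u * walsh S (flip i u))" for i
    by (rule sum.reindex_bij_witness[of _ "flip i" "flip i"]) auto
  have "fourier (laplacian hypercube g) S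
      = (\<Sum>u\<in>UNIV. \<Sum>i\<in>UNIV. g $ flip i u * walsh S u - g $ u * walsh S u)"
    by (simp add: fourier_def laplacian_hypercube sum_distrib_right left_diff_distrib)
  also have "\<dots> = (\<Sum>i\<in>UNIV. (\<Sum>u\<in>UNIV. g $ u * walsh S (flip i u)) - fourier g S)"
    by (subst sum.swap) (simp add: sum_subtractf reflect fourier_def)
  also have "\<dots> = (\<Sum>i\<in>UNIV. if i \<in> S then - 2 * fourier g S else 0)"
    by (intro sum.cong) (auto simp: walsh_flip fourier_def sum_negf)
  also have "\<dots> = - 2 * real (card S) * fourier g S"
    by (simp add: sum.If_cases)
  finally show ?thesis .
qed

text \<open>
  Summing over all sets \<open>S\<close> multiplies out a product with one factor
  $1 + (-1)^{u_i + v_i}$ for each coordinate, and a coordinate where \<open>u\<close> and \<open>v\<close> differ contributes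
  the factor 0. Both Fourier inversion and Parseval's identity come from this relation.
\<close>

lemma walsh_kernel:
  fixes u v :: "bit ^ 'r::finite"
  shows "(\<Sum>S\<in>UNIV. walsh S u * walsh S v) = (if u = v then 2 ^ CARD('r) else 0)"
proof -
  have "(\<Sum>S\<in>UNIV. walsh S u * walsh S v)
      = (\<Sum>S\<in>Pow UNIV. (\<Prod>i\<in>S. rademacher i u * rademacher i v) * (\<Prod>i\<in>UNIV - S. 1))"
    by (simp add: walsh_def prod.distrib)
  also have "\<dots> = (\<Prod>i\<in>UNIV. rademacher i u * rademacher i v + 1)"
    by (rule prod_add[symmetric]) simp
  also have "\<dots> = (if u = v then 2 ^ CARD('r) else 0)"
  proof (cases "u = v")
    case False
    then obtain i where "rademacher i u \<noteq> rademacher i v"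
      using rademacher_separates by blast
    then have "rademacher i u * rademacher i v + 1 = 0"
      by (auto simp: rademacher_def split: if_splits)
    then show ?thesis using False by auto
  qed simp
  finally show ?thesis .
qed

lemma fourier_inversion:
  fixes g :: "real ^ (bit ^ 'r::finite)"
  shows "(\<Sum>S\<in>UNIV. fourier g S * walsh S u) = 2 ^ CARD('r) * g $ u"
proof -
  have "(\<Sum>S\<in>UNIV. fourier g S * walsh S u) = (\<Sum>v\<in>UNIV. g $ v * (\<Sum>S\<in>UNIV. walsh S v * walsh S u))"
    unfolding fourier_def sum_distrib_right sum_distrib_left
    by (subst sum.swap) (simp add: mult.assoc)
  then show ?thesis
    by (simp add: walsh_kernel if_distrib cong: if_cong)
qed

lemma parseval:
  fixes g h :: "real ^ (bit ^ 'r::finite)"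
  shows "(\<Sum>S\<in>UNIV. fourier g S * fourier h S) = 2 ^ CARD('r) * (g \<bullet> h)"
proof -
  have "(\<Sum>S\<in>UNIV. fourier g S * fourier h S) = (\<Sum>u\<in>UNIV. h $ u * (\<Sum>S\<in>UNIV. fourier g S * walsh S u))"
    unfolding fourier_def[of h] sum_distrib_left
    by (subst sum.swap) (simp add: mult_ac)
  then show ?thesis
    by (simp add: fourier_inversion inner_vec_def sum_distrib_left mult_ac)
qed

text \<open>
  In Fourier coordinates the Laplacian is multiplication by $-2|S|$, and having mean zero excludes
  the only set with $|S| < 1$.
\<close>

lemma poincare_hypercube:
  fixes g :: "real ^ (bit ^ 'r::finite)"
  assumes "(\<Sum>u\<in>UNIV. g $ u) = 0"
  shows "laplacian hypercube g \<bullet> g \<le> - 2 * (g \<bullet> g)"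
proof -
  have "fourier g {} = 0"
    using assms by (simp add: fourier_def walsh_def)
  then have le: "fourier g S * fourier g S \<le> real (card S) * (fourier g S * fourier g S)" for S
  proof (cases "S = {}")
    case False
    then have "1 \<le> real (card S)"
      by (simp add: Suc_le_eq card_gt_0_iff)
    then show ?thesis
      using mult_right_mono[of 1 "real (card S)" "fourier g S * fourier g S"] by simp
  qed (use \<open>fourier g {} = 0\<close> in simp)
  have "2 ^ CARD('r) * (laplacian hypercube g \<bullet> g) = (\<Sum>S\<in>UNIV. - 2 * (real (card S) * (fourier g S * fourier g S)))"
    by (simp add: parseval[symmetric] fourier_laplacian mult.assoc)
  also have "\<dots> \<le> (\<Sum>S\<in>UNIV. - 2 * (fourier g S * fourier g S))"
    using le by (intro sum_mono) auto
  also have "\<dots> = 2 ^ CARD('r) * (- 2 * (g \<bullet> g))"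
    by (simp add: parseval sum_distrib_left[symmetric] sum_negf)
  finally show ?thesis
    by (rule mult_left_le_imp_le) simp
qed

section \<open>The eigenspace of the hypercube\<close>

lemma E2_iff: "f \<in> E2 G \<longleftrightarrow> (\<forall>x. laplacian G f $ x = - 2 * f $ x)"
  by (simp add: E2_def vec_eq_iff eq_neg_iff_add_eq_0)

lemma subspace_E2: "subspace (E2 G)"
proof -
  have "linear (\<lambda>f. laplacian G f + 2 *\<^sub>R f)"
    by (rule linearI)
      (simp_all add: laplacian_def vec_eq_iff sum.distrib sum_subtractf sum_distrib_left algebra_simps)
  then show ?thesis
    unfolding E2_def by (rule linear_subspace_kernel)
qed

text \<open>
  With the $r$ coordinates as parameters, this map is a linear isomorphism onto \<open>E2\<close> of the cube, by
  \<open>inj_sign_form\<close> and \<open>E2_hypercube\<close>.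
\<close>

definition sign_form :: "real ^ 'r \<Rightarrow> real ^ (bit ^ 'r::finite)" where
  "sign_form a = (\<chi> u. \<Sum>i\<in>UNIV. a $ i * rademacher i u)"

lemma linear_sign_form: "linear sign_form"
  by (rule linearI) (simp_all add: sign_form_def vec_eq_iff sum.distrib sum_distrib_left algebra_simps)

lemma sign_form_flip:
  "sign_form a $ flip i u = sign_form a $ u - 2 * (a $ i * rademacher i u)"
proof -
  have "sign_form a $ u - sign_form a $ flip i u = (\<Sum>j\<in>UNIV. if j = i then 2 * (a $ i * rademacher i u) else 0)"
    unfolding sign_form_def vec_lambda_beta sum_subtractf[symmetric]
    by (intro sum.cong) (auto simp: rademacher_flip)
  then show ?thesis by simp
qed

lemma inj_sign_form: "inj sign_form"
proof (rule injI)
  fix a b :: "real ^ 'r" assume eq: "sign_form a = sign_form b"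
  have "a $ i = b $ i" for i
    using sign_form_flip[of a i 0] sign_form_flip[of b i 0] eq by (simp add: rademacher_def)
  then show "a = b" by (simp add: vec_eq_iff)
qed

text \<open>
  An eigenfunction for $-2$ has its Fourier coefficients supported on the sets with $-2|S| = -2$,
  which are the singletons, and the Walsh functions of singletons are the coordinate signs.
\<close>

lemma E2_hypercube: "E2 hypercube = range sign_form"
proof (intro equalityI subsetI)
  fix g :: "real ^ (bit ^ 'r)" assume "g \<in> E2 hypercube"
  then have eig: "laplacian hypercube g $ u = - 2 * g $ u" for u
    by (simp add: E2_iff)
  have vanish: "fourier g S = 0" if "card S \<noteq> 1" for S
  proof -
    have "fourier (laplacian hypercube g) S = - 2 * fourier g S"
      unfolding fourier_def eig by (simp add: sum_distrib_left mult_ac)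
    then show ?thesis using that by (simp add: fourier_laplacian)
  qed
  have "g $ u = sign_form (\<chi> i. fourier g {i} / 2 ^ CARD('r)) $ u" for u
  proof -
    have "2 ^ CARD('r) * g $ u = (\<Sum>S\<in>UNIV. fourier g S * walsh S u)"
      by (simp add: fourier_inversion)
    also have "\<dots> = (\<Sum>S\<in>range (\<lambda>i. {i}). fourier g S * walsh S u)"
      using vanish by (intro sum.mono_neutral_right) (auto simp: card_1_singleton_iff)
    also have "\<dots> = (\<Sum>i\<in>UNIV. fourier g {i} * rademacher i u)"
      by (subst sum.reindex) (auto simp: walsh_def)
    finally show ?thesis
      by (simp add: sign_form_def sum_divide_distrib[symmetric] field_simps)
  qed
  then show "g \<in> range sign_form"
    by (metis rangeI vec_eq_iff)
next
  fix g :: "real ^ (bit ^ 'r)" assume "g \<in> range sign_form"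
  then obtain a where g: "g = sign_form a" by blast
  have "laplacian hypercube g $ u = - 2 * g $ u" for u
    by (simp add: g laplacian_hypercube sign_form_flip sum_negf sum_distrib_left[symmetric])
      (simp add: sign_form_def)
  then show "g \<in> E2 hypercube"
    by (simp add: E2_iff)
qed

lemma dim_E2_hypercube: "dim (E2 (hypercube :: (bit ^ 'r::finite) graph)) = CARD('r)"
proof -
  have "dim (range (sign_form :: real ^ 'r \<Rightarrow> _)) = dim (UNIV :: (real ^ 'r) set)"
    using linear_sign_form inj_sign_form
    by (intro dim_image_eq) (auto intro: inj_on_subset)
  then show ?thesis by (simp add: E2_hypercube)
qed

text \<open>
  Rapidly growing weights have no nontrivial relation with coefficients in $\{-1, 0, 1\}$: when
  each new weight exceeds the sum of the old ones, its coefficient has to vanish. Nonnegativity is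
  carried along so that this sum bounds every signed partial sum.
\<close>

lemma dissociated_weights:
  assumes "finite A"
  shows "\<exists>a :: 'i \<Rightarrow> real. (\<forall>i\<in>A. 0 \<le> a i) \<and>
    (\<forall>c. (\<forall>i\<in>A. c i \<in> {-1, 0, 1}) \<and> (\<Sum>i\<in>A. a i * c i) = 0 \<longrightarrow> (\<forall>i\<in>A. c i = 0))"
  using assms
proof (induction A)
  case (insert k A)
  then obtain a :: "'i \<Rightarrow> real" where nonneg: "\<forall>i\<in>A. 0 \<le> a i"
    and dis: "\<forall>c. (\<forall>i\<in>A. c i \<in> {-1, 0, 1}) \<and> (\<Sum>i\<in>A. a i * c i) = 0 \<longrightarrow> (\<forall>i\<in>A. c i = 0)"
    by (elim exE conjE)
  define b where "b = a(k := 1 + sum a A)"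
  have b_A: "b i = a i" if "i \<in> A" for i
    using that insert.hyps by (auto simp: b_def)
  have "\<forall>i\<in>insert k A. c i = 0"
    if c: "\<forall>i\<in>insert k A. c i \<in> {-1, 0, 1}" and 0: "(\<Sum>i\<in>insert k A. b i * c i) = 0" for c
  proof -
    have split: "(1 + sum a A) * c k + (\<Sum>i\<in>A. a i * c i) = 0"
      using 0 insert.hyps b_A by (simp add: b_def)
    have "\<bar>\<Sum>i\<in>A. a i * c i\<bar> \<le> (\<Sum>i\<in>A. \<bar>a i * c i\<bar>)"
      by (rule sum_abs)
    also have "\<dots> \<le> sum a A"
      using c nonneg by (intro sum_mono) (auto simp: abs_mult)
    finally have "\<bar>\<Sum>i\<in>A. a i * c i\<bar> \<le> sum a A" .
    then have "c k = 0"
      using split c by auto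
    then show ?thesis
      using dis c split by auto
  qed
  moreover have "\<forall>i\<in>insert k A. 0 \<le> b i"
    using nonneg b_A by (auto simp: b_def sum_nonneg)
  ultimately show ?case by blast
qed auto

text \<open>
  The difference of two values of a sign form is twice a combination of the weights with
  coefficients in $\{-1, 0, 1\}$, so dissociated weights separate all vertices of the cube.
\<close>

lemma injective_E2_hypercube:
  "\<exists>g \<in> E2 (hypercube :: (bit ^ 'r::finite) graph). inj (($) g)"
proof -
  obtain a :: "'r \<Rightarrow> real" where dis: "\<forall>c. (\<forall>i\<in>UNIV. c i \<in> {-1, 0, 1}) \<and> (\<Sum>i\<in>UNIV. a i * c i) = 0 \<longrightarrow> (\<forall>i\<in>UNIV. c i = 0)"
    using dissociated_weights[of "UNIV :: 'r set", OF finite_class.finite_UNIV] by (elim exE conjE)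
  have "inj (($) (sign_form (\<chi> i. a i)))"
  proof (rule injI)
    fix u v assume eq: "sign_form (\<chi> i. a i) $ u = sign_form (\<chi> i. a i) $ v"
    let ?c = "\<lambda>i. (rademacher i u - rademacher i v) / 2"
    have "(\<Sum>i\<in>UNIV. a i * ?c i) = (sign_form (\<chi> i. a i) $ u - sign_form (\<chi> i. a i) $ v) / 2"
      by (simp add: sign_form_def sum_subtractf[symmetric] sum_divide_distrib right_diff_distrib)
    then have "(\<Sum>i\<in>UNIV. a i * ?c i) = 0"
      unfolding eq by simp
    moreover have "\<forall>i\<in>UNIV. ?c i \<in> {-1, 0, 1}"
      by (simp add: rademacher_def)
    ultimately have "\<forall>i\<in>UNIV. ?c i = 0"
      using dis[THEN spec, of ?c] by blast
    then show "u = v"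
      by (intro rademacher_separates) simp
  qed
  then show ?thesis by (auto simp: E2_hypercube)
qed

section \<open>Invariance under graph isomorphism\<close>

lemma graph_iso_inv:
  assumes "graph_iso G H \<psi>"
  shows "graph_iso H G (inv \<psi>)"
proof -
  have "bij \<psi>" and edges: "\<And>x y. G x y \<longleftrightarrow> H (\<psi> x) (\<psi> y)"
    using assms by (auto simp: graph_iso_def)
  then show ?thesis
    by (simp add: graph_iso_def bij_imp_bij_inv edges surj_f_inv_f bij_is_surj)
qed

lemma graph_Aut_comp: "\<phi> \<in> graph_Aut G \<Longrightarrow> \<psi> \<in> graph_Aut G \<Longrightarrow> \<phi> \<circ> \<psi> \<in> graph_Aut G"
  unfolding graph_Aut_def graph_iso_def mem_Collect_eq by (metis bij_comp comp_apply)

definition pullback :: "('p \<Rightarrow> 'q) \<Rightarrow> real ^ 'q::finite \<Rightarrow> real ^ 'p::finite" where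
  "pullback \<psi> f = (\<chi> p. f $ \<psi> p)"

lemma laplacian_pullback:
  assumes "graph_iso X Y \<psi>"
  shows "laplacian X (pullback \<psi> f) = pullback \<psi> (laplacian Y f)"
proof -
  have "bij \<psi>" and edges: "\<And>p q. X p q \<longleftrightarrow> Y (\<psi> p) (\<psi> q)"
    using assms by (auto simp: graph_iso_def)
  have "{q. Y (\<psi> p) q} = \<psi> ` {q. X p q}" for p
    unfolding edges using bij_is_surj[OF \<open>bij \<psi>\<close>] by (auto simp: image_iff surj_def)
  then show ?thesis
    using bij_is_inj[OF \<open>bij \<psi>\<close>]
    by (simp add: vec_eq_iff laplacian_def pullback_def sum.reindex inj_on_subset)
qed

lemma E2_pullback:
  assumes "graph_iso X Y \<psi>" and "f \<in> E2 Y"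
  shows "pullback \<psi> f \<in> E2 X"
  using assms(2) by (simp add: E2_iff laplacian_pullback[OF assms(1)]) (simp add: pullback_def)

lemma m2_graph_iso:
  assumes iso: "graph_iso X Y \<psi>"
  shows "m2 X = m2 Y"
proof -
  have "bij \<psi>" using iso by (simp add: graph_iso_def)
  have section_inv: "pullback \<psi> (pullback (inv \<psi>) f) = f" for f
    using \<open>bij \<psi>\<close> by (simp add: pullback_def vec_eq_iff bij_is_inj)
  have "E2 X = pullback \<psi> ` E2 Y"
    using E2_pullback[OF iso] E2_pullback[OF graph_iso_inv[OF iso]] section_inv
    by (metis (no_types, opaque_lifting) image_iff subset_antisym subsetI)
  moreover have "linear (pullback \<psi>)"
    by (rule linearI) (simp_all add: pullback_def vec_eq_iff)
  moreover have "inj (pullback \<psi>)"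
    using bij_is_surj[OF \<open>bij \<psi>\<close>] by (intro injI) (simp add: pullback_def vec_eq_iff, metis surjD)
  ultimately show ?thesis
    unfolding m2_def by (metis dim_image_eq inj_on_subset subset_UNIV)
qed

section \<open>Eigenfunctions on a bundle of hypercubes\<close>

definition fibre :: "real ^ ('v::finite \<times> 'w::finite) \<Rightarrow> 'v \<Rightarrow> real ^ 'w" where
  "fibre f x = (\<chi> u. f $ (x, u))"

text \<open>
  The neighbours of a vertex split into horizontal and vertical ones. Irreflexivity of the base
  keeps the two kinds disjoint.
\<close>

lemma laplacian_graph_bundle:
  fixes f :: "real ^ ('v::finite \<times> 'w::finite)"
  assumes "irreflp G"
  shows "laplacian (graph_bundle G F \<sigma>) f $ (x, u)
    = (\<Sum>y | G x y. f $ (y, \<sigma> x y u) - f $ (x, u)) + laplacian F (fibre f x) $ u"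
proof -
  let ?H = "(\<lambda>y. (y, \<sigma> x y u)) ` {y. G x y}" and ?V = "Pair x ` {v. F u v}"
  have "{q. graph_bundle G F \<sigma> (x, u) q} = ?H \<union> ?V"
    by (auto simp: graph_bundle_def)
  moreover have "?H \<inter> ?V = {}"
    using assms by (auto dest: irreflpD)
  ultimately have "laplacian (graph_bundle G F \<sigma>) f $ (x, u)
      = (\<Sum>q\<in>?H. f $ q - f $ (x, u)) + (\<Sum>q\<in>?V. f $ q - f $ (x, u))"
    by (simp add: laplacian_def sum.union_disjoint)
  then show ?thesis
    by (simp add: sum.reindex inj_on_def laplacian_def fibre_def)
qed

lemma sum_laplacian_hypercube: "(\<Sum>u\<in>UNIV. laplacian hypercube g $ u) = 0"
  using fourier_laplacian[of g "{}"] by (simp add: fourier_def walsh_def)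

lemma E2_trivial:
  assumes "lambda1 G > 2" and "f \<in> E2 G"
  shows "f = 0"
proof (rule ccontr)
  assume "f \<noteq> 0"
  have "- laplacian G f = 2 *\<^sub>R f"
    using assms(2) by (simp add: E2_iff vec_eq_iff)
  then have "2 \<in> laplace_spectrum G - {0}"
    using \<open>f \<noteq> 0\<close> by (auto simp: laplace_spectrum_def)
  then have "lambda1 G \<le> ereal 2"
    unfolding lambda1_def by (intro Inf_lower imageI)
  then show False using assms(1) by simp
qed

locale hypercube_bundle =
  fixes G :: "'v::finite graph" and \<sigma> :: "'v \<Rightarrow> 'v \<Rightarrow> bit ^ 'r::finite \<Rightarrow> bit ^ 'r"
  assumes simple: "simple_graph G" and data: "bundle_data G hypercube \<sigma>"
begin

abbreviation X :: "('v \<times> (bit ^ 'r)) graph" where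
  "X \<equiv> graph_bundle G hypercube \<sigma>"

lemma G_sym: "G x y \<longleftrightarrow> G y x"
  using simple by (auto simp: simple_graph_def dest: sympD)

lemma irreflp_G: "irreflp G"
  using simple by (simp add: simple_graph_def)

lemma \<sigma>_Aut: "G x y \<Longrightarrow> \<sigma> x y \<in> graph_Aut hypercube"
  using data by (simp add: bundle_data_def)

lemma bij_\<sigma>: "G x y \<Longrightarrow> bij (\<sigma> x y)"
  using \<sigma>_Aut by (simp add: graph_Aut_def graph_iso_def)

lemma \<sigma>_inverse: "G x y \<Longrightarrow> \<sigma> y x (\<sigma> x y u) = u"
  using data bij_\<sigma> by (simp add: bundle_data_def bij_is_inj)

lemma sum_\<sigma>: "G x y \<Longrightarrow> (\<Sum>u\<in>UNIV. h (\<sigma> x y u)) = (\<Sum>u\<in>UNIV. h u)"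
  by (rule sum.reindex_bij_betw) (rule bij_\<sigma>)

text \<open>
  These functions are the covariantly constant ones if \<open>\<sigma>\<close> is read as a connection.
\<close>

definition parallel :: "real ^ ('v \<times> (bit ^ 'r)) \<Rightarrow> bool" where
  "parallel f \<longleftrightarrow> (\<forall>x y u. G x y \<longrightarrow> f $ (y, \<sigma> x y u) = f $ (x, u))"

lemma parallel_E2I:
  assumes "parallel f" and "\<And>x. fibre f x \<in> E2 hypercube"
  shows "f \<in> E2 X"
proof -
  have "laplacian X f $ (x, u) = - 2 * f $ (x, u)" for x u
  proof -
    have "laplacian X f $ (x, u) = laplacian hypercube (fibre f x) $ u"
      using assms(1) by (simp add: laplacian_graph_bundle[OF irreflp_G] parallel_def)
    also have "\<dots> = - 2 * f $ (x, u)"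
      using assms(2)[of x] by (simp add: E2_iff fibre_def)
    finally show ?thesis .
  qed
  then show ?thesis
    by (auto simp: E2_iff)
qed

text \<open>
  Summation over the fibres intertwines the Laplacian of the bundle with that of the base: the maps
  \<open>\<sigma> x y\<close> only permute the summands, and the vertical part sums to zero. The fibre sums thus form an
  element of \<open>E2 G\<close>, a space that the spectral gap makes trivial.
\<close>

lemma fibre_sum_zero:
  assumes "lambda1 G > 2" and "f \<in> E2 X"
  shows "(\<Sum>u\<in>UNIV. f $ (x, u)) = 0"
proof -
  define A where "A = (\<chi> x. \<Sum>u\<in>UNIV. f $ (x, u))"
  have "laplacian G A $ x = - 2 * A $ x" for x
  proof -
    have "(\<Sum>u\<in>UNIV. f $ (y, u) - f $ (x, u)) = (\<Sum>u\<in>UNIV. f $ (y, \<sigma> x y u) - f $ (x, u))" if "G x y" for y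
      using sum_\<sigma>[OF that, of "\<lambda>u. f $ (y, u)"] by (simp add: sum_subtractf)
    then have "laplacian G A $ x = (\<Sum>y | G x y. \<Sum>u\<in>UNIV. f $ (y, \<sigma> x y u) - f $ (x, u))"
      by (simp add: laplacian_def A_def sum_subtractf[symmetric])
    also have "\<dots> = (\<Sum>u\<in>UNIV. laplacian X f $ (x, u) - laplacian hypercube (fibre f x) $ u)"
      by (subst sum.swap) (simp add: laplacian_graph_bundle[OF irreflp_G])
    also have "\<dots> = (\<Sum>u\<in>UNIV. laplacian X f $ (x, u))"
      by (simp add: sum_subtractf sum_laplacian_hypercube)
    also have "\<dots> = (\<Sum>u\<in>UNIV. - 2 * f $ (x, u))"
      using assms(2) by (simp add: E2_iff)
    finally show ?thesis
      by (simp add: A_def sum_distrib_left sum_negf)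
  qed
  then have "A = 0"
    using E2_trivial[OF assms(1)] by (simp add: E2_iff)
  then show ?thesis
    by (simp add: A_def vec_eq_iff)
qed

text \<open>
  Take the inner product of the eigenvalue equation with \<open>f\<close>. After symmetrization over the two
  orientations of an edge, the horizontal terms are minus half the sum of the squares of the
  differences of \<open>f\<close> along horizontal edges, and the remaining vertical terms are nonpositive by the
  Poincare inequality. Two nonpositive quantities with sum zero both vanish.
\<close>

lemma E2_parallel:
  assumes "lambda1 G > 2" and "f \<in> E2 X"
  shows "parallel f"
proof -
  \<comment> \<open>The inner product of the eigenvalue equation with \<open>f\<close> over the fibre at \<open>x\<close> is the row sum
    of \<open>H\<close> plus \<open>V x\<close>. The Dirichlet energy of an edge, \<open>D x y\<close>, is set to 0 off the edges so that
    the double sums can be swapped freely.\<close>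
  define d where "d x y u = f $ (y, \<sigma> x y u) - f $ (x, u)" for x y u
  define H where "H x y = (\<Sum>u\<in>UNIV. f $ (x, u) * d x y u)" for x y
  define D where "D x y = (if G x y then \<Sum>u\<in>UNIV. (d x y u)\<^sup>2 else 0)" for x y
  define S where "S = (\<Sum>x\<in>UNIV. \<Sum>y\<in>UNIV. if G x y then H x y else 0)"
  define V where "V x = laplacian hypercube (fibre f x) \<bullet> fibre f x + 2 * (fibre f x \<bullet> fibre f x)" for x
  have H_sym: "H x y + H y x = - (\<Sum>u\<in>UNIV. (d x y u)\<^sup>2)" if "G x y" for x y
  proof -
    have "H y x = (\<Sum>u\<in>UNIV. f $ (y, \<sigma> x y u) * (f $ (x, u) - f $ (y, \<sigma> x y u)))"
      using sum_\<sigma>[OF that, of "\<lambda>u. f $ (y, u) * d y x u"] that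
      by (simp add: H_def d_def \<sigma>_inverse)
    then have "H x y + H y x = (\<Sum>u\<in>UNIV. f $ (x, u) * d x y u
        + f $ (y, \<sigma> x y u) * (f $ (x, u) - f $ (y, \<sigma> x y u)))"
      by (simp add: H_def sum.distrib)
    also have "\<dots> = (\<Sum>u\<in>UNIV. - (d x y u)\<^sup>2)"
      by (intro sum.cong) (simp_all add: d_def power2_eq_square algebra_simps)
    finally show ?thesis by (simp add: sum_negf)
  qed
  have "S = (\<Sum>x\<in>UNIV. \<Sum>y\<in>UNIV. if G x y then H y x else 0)"
    unfolding S_def by (subst sum.swap) (simp add: G_sym)
  then have "2 * S = (\<Sum>x\<in>UNIV. \<Sum>y\<in>UNIV. (if G x y then H x y else 0) + (if G x y then H y x else 0))"
    by (simp add: S_def sum.distrib)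
  also have "\<dots> = (\<Sum>x\<in>UNIV. \<Sum>y\<in>UNIV. - D x y)"
    using H_sym by (intro sum.cong) (auto simp: D_def)
  finally have S: "2 * S = - (\<Sum>x\<in>UNIV. \<Sum>y\<in>UNIV. D x y)"
    by (simp add: sum_negf)
  have row: "(\<Sum>y\<in>UNIV. if G x y then H x y else 0) + V x = 0" for x
  proof -
    have "(\<Sum>y\<in>UNIV. if G x y then H x y else 0) = (\<Sum>y | G x y. H x y)"
      by (simp add: sum.If_cases)
    also have "\<dots> = (\<Sum>u\<in>UNIV. f $ (x, u) * (\<Sum>y | G x y. d x y u))"
      unfolding H_def sum_distrib_left by (rule sum.swap)
    finally have "(\<Sum>y\<in>UNIV. if G x y then H x y else 0) = (\<Sum>u\<in>UNIV. f $ (x, u) * (\<Sum>y | G x y. d x y u))" .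
    then have "(\<Sum>y\<in>UNIV. if G x y then H x y else 0) + V x
        = (\<Sum>u\<in>UNIV. f $ (x, u) * (laplacian X f $ (x, u) + 2 * f $ (x, u)))"
      by (simp add: V_def inner_vec_def fibre_def d_def laplacian_graph_bundle[OF irreflp_G]
          sum.distrib[symmetric] sum_distrib_left algebra_simps)
    also have "\<dots> = 0"
      using assms(2) by (simp add: E2_iff)
    finally show ?thesis .
  qed
  have V: "V x \<le> 0" for x
    using poincare_hypercube[of "fibre f x"] fibre_sum_zero[OF assms, of x]
    by (simp add: V_def fibre_def)
  have "S + (\<Sum>x\<in>UNIV. V x) = 0"
    using row by (simp add: S_def sum.distrib[symmetric])
  moreover have "(\<Sum>x\<in>UNIV. V x) \<le> 0"
    using V by (intro sum_nonpos) auto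
  ultimately have "(\<Sum>x\<in>UNIV. \<Sum>y\<in>UNIV. D x y) \<le> 0"
    using S by simp
  moreover have D_nonneg: "0 \<le> D x y" for x y
    by (simp add: D_def sum_nonneg)
  ultimately have "(\<Sum>x\<in>UNIV. \<Sum>y\<in>UNIV. D x y) = 0"
    by (intro antisym sum_nonneg) auto
  then have "D x y = 0" for x y
    using D_nonneg by (simp add: sum_nonneg_eq_0_iff sum_nonneg)
  then have "d x y u = 0" if "G x y" for x y u
    using that unfolding D_def by (metis (mono_tags, lifting) UNIV_I finite power_eq_0_iff sum_nonneg_eq_0_iff zero_le_power2)
  then show ?thesis
    by (simp add: parallel_def d_def)
qed

lemma fibre_E2:
  assumes "lambda1 G > 2" and "f \<in> E2 X"
  shows "fibre f x \<in> E2 hypercube"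
proof -
  have "laplacian X f $ (x, u) = laplacian hypercube (fibre f x) $ u" for u
    using E2_parallel[OF assms] by (simp add: laplacian_graph_bundle[OF irreflp_G] parallel_def)
  then show ?thesis
    using assms(2) by (simp add: E2_iff) (simp add: fibre_def)
qed

text \<open>
  Vanishing spreads from a fibre to the neighbouring ones because each \<open>\<sigma> x y\<close> is onto.
\<close>

lemma parallel_zero:
  assumes "connected_graph G" and "parallel f" and "fibre f x0 = 0"
  shows "f = 0"
proof -
  have "\<forall>u. f $ (x, u) = 0" if "G\<^sup>*\<^sup>* x0 x" for x
    using that
  proof induction
    case base
    then show ?case using assms(3) by (simp add: fibre_def vec_eq_iff)
  next
    case (step y z)
    then show ?case
      using assms(2) bij_is_surj[OF bij_\<sigma>[OF step.hyps(2)]] unfolding parallel_def by (metis surjD)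
  qed
  then show ?thesis
    using assms(1) by (auto simp: vec_eq_iff connected_graph_def)
qed

text \<open>
  Restriction to one fibre is injective on \<open>E2 X\<close>, so no dimension is lost.
\<close>

lemma m2_eq_dim_fibre:
  assumes "connected_graph G" and "lambda1 G > 2"
  shows "m2 X = dim ((\<lambda>f. fibre f x0) ` E2 X)"
proof -
  have lin: "linear (\<lambda>f :: real ^ ('v \<times> (bit ^ 'r)). fibre f x0)"
    by (rule linearI) (simp_all add: fibre_def vec_eq_iff)
  have "inj_on (\<lambda>f. fibre f x0) (E2 X)"
    unfolding linear_inj_on_iff_eq_0[OF lin subspace_E2]
    using parallel_zero[OF assms(1) E2_parallel[OF assms(2)]] by blast
  then have "inj_on (\<lambda>f. fibre f x0) (span (E2 X))"
    using subspace_E2 by (metis span_eq_iff)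
  then show ?thesis
    unfolding m2_def by (rule dim_image_eq[OF lin, symmetric])
qed

section \<open>Parallel transport\<close>

lemma transport_parallel:
  assumes "parallel f" and "walk G \<gamma>"
  shows "f $ (last \<gamma>, transport \<sigma> \<gamma> u) = f $ (hd \<gamma>, u)"
  using assms(2)
proof (induction \<gamma> arbitrary: u rule: induct_list012)
  case (3 x y \<gamma>)
  then show ?case
    using assms(1) by (auto simp: walk_def parallel_def)
qed (auto simp: walk_def)

lemma transport_Aut: "walk G \<gamma> \<Longrightarrow> transport \<sigma> \<gamma> \<in> graph_Aut hypercube"
proof (induction \<gamma> rule: induct_list012)
  case (3 x y \<gamma>)
  then have "transport \<sigma> (y # \<gamma>) \<in> graph_Aut hypercube" and "G x y"
    by (simp_all add: walk_def)
  then show ?case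
    using graph_Aut_comp[OF _ \<sigma>_Aut] by (simp only: transport.simps)
qed (auto simp: walk_def graph_Aut_def graph_iso_def)

lemma inj_transport: "walk G \<gamma> \<Longrightarrow> inj (transport \<sigma> \<gamma>)"
  using transport_Aut by (auto simp: graph_Aut_def graph_iso_def bij_is_inj)

lemma transport_append:
  "transport \<sigma> (\<alpha> @ y # \<beta>) = transport \<sigma> (y # \<beta>) \<circ> transport \<sigma> (\<alpha> @ [y])"
  by (induction \<alpha> rule: induct_list012) auto

lemma walk_rev: "walk G (rev \<gamma>) \<longleftrightarrow> walk G \<gamma>"
  using G_sym by (simp add: walk_def successively_rev)

lemma transport_rev:
  "walk G \<gamma> \<Longrightarrow> transport \<sigma> (rev \<gamma>) (transport \<sigma> \<gamma> u) = u"
proof (induction \<gamma> arbitrary: u rule: induct_list012)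
  case (3 x y \<gamma>)
  then show ?case
    using transport_append[of "rev \<gamma>" y "[x]"] by (simp add: walk_def \<sigma>_inverse)
qed (auto simp: walk_def)

lemma connecting_walk:
  assumes "connected_graph G"
  shows "\<exists>\<gamma>. walk G \<gamma> \<and> hd \<gamma> = x \<and> last \<gamma> = y"
proof -
  have "G\<^sup>*\<^sup>* x y" using assms by (simp add: connected_graph_def)
  then show ?thesis
  proof (induction rule: converse_rtranclp_induct)
    case base
    have "walk G [y]" by (simp add: walk_def)
    then show ?case by (metis last.simps list.sel(1))
  next
    case (step x z)
    then obtain \<gamma> where "walk G \<gamma>" "hd \<gamma> = z" "last \<gamma> = y" by blast
    then have "walk G (x # \<gamma>)" "hd (x # \<gamma>) = x" "last (x # \<gamma>) = y"
      using step.hyps(1) by (auto simp: walk_def successively_Cons)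
    then show ?case by blast
  qed
qed

lemma id_in_holonomy: "id \<in> holonomy G \<sigma> x0"
proof -
  have "walk G [x0]" "transport \<sigma> [x0] = id" by (simp_all add: walk_def)
  then show ?thesis
    unfolding holonomy_def by (smt (verit, best) last.simps list.sel(1) mem_Collect_eq)
qed

lemma holonomy_invariant:
  assumes "\<tau> \<in> holonomy G \<sigma> x0" and "parallel f"
  shows "f $ (x0, \<tau> u) = f $ (x0, u)"
  using assms(1) transport_parallel[OF assms(2)] unfolding holonomy_def by fastforce

text \<open>
  Let \<open>\<phi> x\<close> be the transport along a chosen walk from \<open>x0\<close> to \<open>x\<close>. For an edge from \<open>x\<close> to \<open>y\<close>,
  going out along the walk to \<open>x\<close>, over the edge, and back along the walk to \<open>y\<close> is a closed walk.
  Its trivial transport says that \<open>\<phi> y\<close> agrees with \<open>\<sigma> x y \<circ> \<phi> x\<close>.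
\<close>

lemma parallel_frame:
  assumes "connected_graph G" and trivial: "holonomy G \<sigma> x0 = {id}"
  shows "\<exists>\<phi>. (\<forall>x. \<phi> x \<in> graph_Aut hypercube) \<and> (\<forall>x y. G x y \<longrightarrow> \<phi> y = \<sigma> x y \<circ> \<phi> x)"
proof -
  obtain \<gamma> where \<gamma>: "\<And>x. walk G (\<gamma> x)" "\<And>x. hd (\<gamma> x) = x0" "\<And>x. last (\<gamma> x) = x"
    using connecting_walk[OF assms(1)] by metis
  define \<phi> where "\<phi> x = transport \<sigma> (\<gamma> x)" for x
  have "\<phi> y = \<sigma> x y \<circ> \<phi> x" if xy: "G x y" for x y
  proof
    fix u
    have ne: "\<gamma> z \<noteq> []" for z using \<gamma>(1)[of z] by (simp add: walk_def)
    have hd_rev: "hd (rev (\<gamma> y)) = y" using \<gamma>(3) by (simp add: hd_rev)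
    have closed: "walk G (\<gamma> x @ rev (\<gamma> y))"
      using \<gamma>(1)[of x] walk_rev[of "\<gamma> y"] \<gamma>(1)[of y] \<gamma>(3)[of x] hd_rev xy
      by (simp add: walk_def successively_append_iff)
    have "transport \<sigma> (\<gamma> x @ rev (\<gamma> y)) \<in> holonomy G \<sigma> x0"
      unfolding holonomy_def using closed \<gamma>(2) ne
      by (intro CollectI exI[of _ "\<gamma> x @ rev (\<gamma> y)"]) (simp add: last_rev)
    then have "transport \<sigma> (\<gamma> x @ rev (\<gamma> y)) u = u"
      using trivial by simp
    moreover have "transport \<sigma> (\<gamma> x @ rev (\<gamma> y)) = transport \<sigma> (rev (\<gamma> y)) \<circ> transport \<sigma> (\<gamma> x @ [y])"
      using transport_append[of "\<gamma> x" y "tl (rev (\<gamma> y))"] hd_rev ne[of y]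
      by (metis list.collapse rev_is_Nil_conv)
    moreover have "transport \<sigma> (\<gamma> x @ [y]) = \<sigma> x y \<circ> \<phi> x"
      using transport_append[of "butlast (\<gamma> x)" x "[y]"] \<gamma>(3)[of x] append_butlast_last_id[OF ne[of x]]
      by (simp add: \<phi>_def) (metis append.assoc append_Cons append_Nil)
    ultimately have "transport \<sigma> (rev (\<gamma> y)) ((\<sigma> x y \<circ> \<phi> x) u) = u"
      by simp
    also have "\<dots> = transport \<sigma> (rev (\<gamma> y)) (\<phi> y u)"
      using transport_rev[OF \<gamma>(1)] by (simp add: \<phi>_def)
    finally show "\<phi> y u = (\<sigma> x y \<circ> \<phi> x) u"
      using inj_transport[of "rev (\<gamma> y)"] \<gamma>(1) walk_rev by (metis injD)
  qed
  moreover have "\<phi> x \<in> graph_Aut hypercube" for x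
    unfolding \<phi>_def by (rule transport_Aut[OF \<gamma>(1)])
  ultimately show ?thesis
    by (intro exI[of _ \<phi>]) simp
qed

text \<open>
  In the coordinates given by a parallel frame every edge of the base acts as the identity. The map
  \<open>\<Phi>\<close> goes from the product to \<open>X\<close>, where no inverse of \<open>\<phi> x\<close> appears in the edge relation, and
  its inverse is the required isomorphism.
\<close>

lemma trivial_holonomy_imp_product:
  assumes "connected_graph G" and "holonomy G \<sigma> x0 = {id}"
  shows "bundle_isomorphic X (cartesian_product G hypercube)"
proof -
  obtain \<phi> where Aut: "\<And>x. \<phi> x \<in> graph_Aut hypercube"
    and frame: "\<And>x y. G x y \<Longrightarrow> \<phi> y = \<sigma> x y \<circ> \<phi> x"
    using parallel_frame[OF assms] by blast
  have bij: "bij (\<phi> x)" for x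
    using Aut by (simp add: graph_Aut_def graph_iso_def)
  have edge: "hypercube (\<phi> x u) (\<phi> x v) \<longleftrightarrow> hypercube u v" for x u v
    using Aut by (simp add: graph_Aut_def graph_iso_def)
  define \<Phi> where "\<Phi> = (\<lambda>(x, u). (x, \<phi> x u))"
  have "bij \<Phi>"
    by (rule o_bij[of "\<lambda>(x, u). (x, inv (\<phi> x) u)"])
      (auto simp: \<Phi>_def fun_eq_iff bij_is_inj[OF bij] surj_f_inv_f[OF bij_is_surj[OF bij]])
  moreover have "cartesian_product G hypercube (x, u) (y, v) \<longleftrightarrow> X (\<Phi> (x, u)) (\<Phi> (y, v))" for x y u v
    using frame[of x y] edge[of x u v] inj_eq[OF bij_is_inj[OF bij[of y]], of v u]
    by (auto simp: cartesian_product_def graph_bundle_def \<Phi>_def)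
  ultimately have iso: "graph_iso (cartesian_product G hypercube) X \<Phi>"
    by (auto simp: graph_iso_def)
  have "fst (\<Phi> p) = fst p" for p
    by (simp add: \<Phi>_def split: prod.split)
  then have "fst (inv \<Phi> q) = fst q" for q
    by (metis \<open>bij \<Phi>\<close> bij_inv_eq_iff)
  then show ?thesis
    using graph_iso_inv[OF iso] by (auto simp: bundle_isomorphic_def fun_eq_iff)
qed

text \<open>
  A holonomy element preserves the values of \<open>f\<close> on the fibre, and these values are distinct.
\<close>

lemma injective_E2_imp_trivial_holonomy:
  assumes "lambda1 G > 2" and "f \<in> E2 X" and "\<forall>x. inj_on (\<lambda>p. f $ p) ({x} \<times> UNIV)"
  shows "holonomy G \<sigma> x0 = {id}"
proof -
  have "\<tau> = id" if "\<tau> \<in> holonomy G \<sigma> x0" for \<tau>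
  proof
    fix u
    have "f $ (x0, \<tau> u) = f $ (x0, u)"
      using holonomy_invariant[OF that E2_parallel[OF assms(1,2)]] .
    then show "\<tau> u = id u"
      using assms(3) by (auto dest!: spec[of _ x0] dest: inj_onD)
  qed
  then show ?thesis using id_in_holonomy by blast
qed

text \<open>
  By the dimension count every element of \<open>E2\<close> of the cube extends to a parallel function on the
  bundle. Extending an injective one already rules out nontrivial holonomy.
\<close>

lemma full_m2_imp_trivial_holonomy:
  assumes "connected_graph G" and "lambda1 G > 2" and "m2 X = CARD('r)"
  shows "holonomy G \<sigma> x0 = {id}"
proof -
  have "linear (\<lambda>f :: real ^ ('v \<times> (bit ^ 'r)). fibre f x0)"
    by (rule linearI) (simp_all add: fibre_def vec_eq_iff)
  then have "subspace ((\<lambda>f. fibre f x0) ` E2 X)"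
    using subspace_E2 by (rule linear_subspace_image)
  then have onto: "(\<lambda>f. fibre f x0) ` E2 X = E2 hypercube"
    using fibre_E2[OF assms(2)] assms(3) m2_eq_dim_fibre[OF assms(1,2), of x0]
    by (intro subspace_dim_equal) (auto simp: subspace_E2 dim_E2_hypercube)
  obtain g :: "real ^ (bit ^ 'r)" where g: "g \<in> E2 hypercube" "inj (($) g)"
    using injective_E2_hypercube by blast
  then obtain f where f: "f \<in> E2 X" "fibre f x0 = g"
    using onto by (metis imageE)
  have "\<tau> = id" if "\<tau> \<in> holonomy G \<sigma> x0" for \<tau>
  proof
    fix u
    have "g $ \<tau> u = g $ u"
      using holonomy_invariant[OF that E2_parallel[OF assms(2) f(1)], of u] f(2)
      by (auto simp: fibre_def)
    then show "\<tau> u = id u"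
      using g(2) by (simp add: inj_eq)
  qed
  then show ?thesis using id_in_holonomy by blast
qed

end

section \<open>The product bundle\<close>

lemma hypercube_bundle_product:
  "simple_graph G \<Longrightarrow> hypercube_bundle G (\<lambda>_ _. id :: bit ^ 'r::finite \<Rightarrow> bit ^ 'r)"
  by (simp add: hypercube_bundle_def bundle_data_def graph_Aut_def graph_iso_def)

lemma constant_extension_E2:
  fixes g :: "real ^ (bit ^ 'r::finite)" and G :: "'v::finite graph"
  assumes "simple_graph G" and "g \<in> E2 hypercube"
  shows "pullback snd g \<in> E2 (cartesian_product G hypercube)"
proof -
  interpret product: hypercube_bundle G "\<lambda>_ _. id :: bit ^ 'r \<Rightarrow> bit ^ 'r"
    using assms(1) by (rule hypercube_bundle_product)
  have "fibre (pullback snd g) x = g" for x :: 'v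
    by (simp add: fibre_def pullback_def vec_eq_iff)
  then show ?thesis
    unfolding cartesian_product_def using assms(2)
    by (intro product.parallel_E2I) (auto simp: product.parallel_def pullback_def)
qed

text \<open>
  In the product every eigenfunction of the cube extends constantly in the base direction, so the
  restriction to a fibre is onto.
\<close>

lemma m2_product:
  fixes G :: "'v::finite graph"
  assumes "simple_graph G" and "connected_graph G" and "lambda1 G > 2"
  shows "m2 (cartesian_product G (hypercube :: (bit ^ 'r::finite) graph)) = CARD('r)"
proof -
  interpret product: hypercube_bundle G "\<lambda>_ _. id :: bit ^ 'r \<Rightarrow> bit ^ 'r"
    using assms(1) by (rule hypercube_bundle_product)
  fix x0 :: 'v
  have "g \<in> (\<lambda>f. fibre f x0) ` E2 product.X" if "g \<in> E2 hypercube" for g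
    using constant_extension_E2[OF assms(1) that]
    by (intro image_eqI[of _ _ "pullback snd g"]) (auto simp: fibre_def pullback_def vec_eq_iff cartesian_product_def)
  then have "(\<lambda>f. fibre f x0) ` E2 product.X = E2 hypercube"
    using product.fibre_E2[OF assms(3)] by blast
  then show ?thesis
    using product.m2_eq_dim_fibre[OF assms(2,3), of x0]
    by (simp add: cartesian_product_def dim_E2_hypercube)
qed

lemma product_imp_injective_E2:
  fixes X :: "('v::finite \<times> (bit ^ 'r::finite)) graph"
  assumes "simple_graph G" and "bundle_isomorphic X (cartesian_product G hypercube)"
  shows "\<exists>f \<in> E2 X. \<forall>x. inj_on (\<lambda>p. f $ p) ({x} \<times> UNIV)"
proof -
  obtain \<psi> :: "'v \<times> (bit ^ 'r) \<Rightarrow> 'v \<times> (bit ^ 'r)"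
    where iso: "graph_iso X (cartesian_product G hypercube) \<psi>" and over: "fst \<circ> \<psi> = fst"
    using assms(2) unfolding bundle_isomorphic_def by blast
  obtain g :: "real ^ (bit ^ 'r)" where g: "g \<in> E2 hypercube" "inj (($) g)"
    using injective_E2_hypercube by blast
  have "inj_on (\<lambda>p. pullback \<psi> (pullback snd g) $ p) ({x} \<times> UNIV)" for x
  proof (rule inj_onI)
    fix p q assume "p \<in> {x} \<times> UNIV" "q \<in> {x} \<times> UNIV"
      and "pullback \<psi> (pullback snd g) $ p = pullback \<psi> (pullback snd g) $ q"
    then have "snd (\<psi> p) = snd (\<psi> q)" "fst (\<psi> p) = fst (\<psi> q)"
      using g(2) over by (auto simp: pullback_def inj_eq fun_eq_iff)
    then have "\<psi> p = \<psi> q" by (rule prod_eqI[rotated])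
    then show "p = q"
      using iso by (simp add: graph_iso_def bij_is_inj inj_eq)
  qed
  then show ?thesis
    using E2_pullback[OF iso constant_extension_E2[OF assms(1) g(1)]] by blast
qed

theorem theorem6p10:
  fixes G' :: "'v::finite graph"
    and \<sigma> :: "'v \<Rightarrow> 'v \<Rightarrow> (bit ^ 'r::finite) \<Rightarrow> (bit ^ 'r)"
    and X :: "('v \<times> (bit ^ 'r)) graph"
  assumes "simple_graph G'"
    and "connected_graph G'"
    and "lambda1 G' > 2"
    and "bundle_data G' hypercube \<sigma>"
    and "X = graph_bundle G' hypercube \<sigma>"
  shows "(bundle_isomorphic X (cartesian_product G' hypercube) \<longleftrightarrow>
            (\<exists>f \<in> E2 X. \<forall>x. inj_on (\<lambda>p. f $ p) ({x} \<times> UNIV))) \<and>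
         ((\<exists>f \<in> E2 X. \<forall>x. inj_on (\<lambda>p. f $ p) ({x} \<times> UNIV)) \<longleftrightarrow>
            (\<forall>x0. holonomy G' \<sigma> x0 = {id})) \<and>
         ((\<forall>x0. holonomy G' \<sigma> x0 = {id}) \<longleftrightarrow> m2 X = CARD('r))"
    (is "(?i \<longleftrightarrow> ?ii) \<and> (?ii \<longleftrightarrow> ?iii) \<and> (?iii \<longleftrightarrow> ?iv)")
proof -
  interpret twisted: hypercube_bundle G' \<sigma>
    using assms(1,4) by (rule hypercube_bundle.intro)
  have "?ii" if "?i"
    using product_imp_injective_E2[OF assms(1) that] .
  moreover have "?iii" if "?ii"
    using that twisted.injective_E2_imp_trivial_holonomy[OF assms(3)] unfolding assms(5) by blast
  moreover have "?i" if "?iii"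
    using that twisted.trivial_holonomy_imp_product[OF assms(2)] unfolding assms(5) by blast
  moreover have "?iv" if "?i"
    using that m2_product[OF assms(1-3), where 'r = 'r]
    unfolding bundle_isomorphic_def by (metis m2_graph_iso)
  moreover have "?iii" if "?iv"
    using that twisted.full_m2_imp_trivial_holonomy[OF assms(2,3)] unfolding assms(5) by blast
  ultimately show ?thesis by blast
qed

end
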